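(* Let $F$ be a (plane) forest of size $n$. Then $$\sum_{(F,w)\in B_n(F)}q^{\mathrm{fmaj}(F,w)}=\frac{n!}{\prod_{u\in F}h_u}\prod_{u\in F}[2h_u].$$
   Context: Notation: $[1,n]=\{1,\dots,n\}$, and for a nonnegative integer $m$, $[m]=1+q+\cdots+q^{m-1}$. A forest $F$ is a (plane) rooted forest with vertex set $V(F)$; being plane, its vertices are regarded as distinguishable (implicitly labeled). Its size is the number of vertices. The hook length $h_u$ of a vertex $u$ is the number of vertices of the subtree rooted at $u$ (including $u$). A signed labeling of a forest $F$ of size $n$ is a map $w:V(F)\to\{\pm1,\dots,\pm n\}$ such that $u\mapsto|w(u)|$ is a bijection from $V(F)$ to $[1,n]$. $B_n(F)$ denotes the set of all signed labeled forests $(F,w)$ with underlying forest $F$, i.e. the set of all signed labelings of $F$. Labels are compared in the natural order of the integers. For $(F,w)\in B_n(F)$ define - $\mathrm{Des}(F,w)=\{u\in F: w(u)>w(v),\ v\text{ is the parent of }u\}$ (roots are never in this set); - $\mathrm{maj}(F,w)=\sum_{u\in\mathrm{Des}(F,w)}h_u$; - $\mathrm{n}_1(F,w)=$ the number of negative labels of $w$; - $\mathrm{fmaj}(F,w)=2\,\mathrm{maj}(F,w)+\mathrm{n}_1(F,w)$. *)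

theory Defs
  imports "HOL-Library.FuncSet" "HOL-Library.Sublist" "HOL-Computational_Algebra.Polynomial"
begin

datatype plane_tree = Node (children: "plane_tree list")

type_synonym plane_forest = "plane_tree list"

text \<open>
  Vertices are identified with their addresses: \<open>[i]\<close> is the root of the \<open>i\<close>-th tree,
  and \<open>v @ [i]\<close> is the \<open>i\<close>-th child of \<open>v\<close> (counting from 0). In particular distinct
  vertices stay distinct even if the subtrees below them are isomorphic.
\<close>

fun is_vertex :: "plane_forest \<Rightarrow> nat list \<Rightarrow> bool" where
  "is_vertex F [] \<longleftrightarrow> False"
| "is_vertex F (i # p) \<longleftrightarrow> i < length F \<and> (p = [] \<or> is_vertex (children (F ! i)) p)"

definition vertices :: "plane_forest \<Rightarrow> nat list set" where
  "vertices F = {u. is_vertex F u}"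

definition forest_size :: "plane_forest \<Rightarrow> nat" where
  "forest_size F = card (vertices F)"

definition is_parent :: "plane_forest \<Rightarrow> nat list \<Rightarrow> nat list \<Rightarrow> bool" where
  "is_parent F v u \<longleftrightarrow> v \<in> vertices F \<and> u \<in> vertices F \<and> (\<exists>i. u = v @ [i])"

text \<open>The subtree rooted at \<open>u\<close> consists of the vertices whose address extends that of \<open>u\<close>.\<close>

definition hook_length :: "plane_forest \<Rightarrow> nat list \<Rightarrow> nat" where
  "hook_length F u = card {v \<in> vertices F. prefix u v}"

text \<open>
  Labelings are taken extensional (\<open>undefined\<close> off the vertex set), so that each map on the
  vertices is represented exactly once.
\<close>

definition signed_labelings :: "nat \<Rightarrow> plane_forest \<Rightarrow> (nat list \<Rightarrow> int) set" where
  "signed_labelings n F =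
     {w \<in> vertices F \<rightarrow>\<^sub>E ({- int n..int n} - {0}).
        bij_betw (\<lambda>u. \<bar>w u\<bar>) (vertices F) {1..int n}}"

definition Des :: "plane_forest \<Rightarrow> (nat list \<Rightarrow> int) \<Rightarrow> nat list set" where
  "Des F w = {u \<in> vertices F. \<exists>v. is_parent F v u \<and> w u > w v}"

definition maj :: "plane_forest \<Rightarrow> (nat list \<Rightarrow> int) \<Rightarrow> nat" where
  "maj F w = (\<Sum>u\<in>Des F w. hook_length F u)"

definition n1 :: "plane_forest \<Rightarrow> (nat list \<Rightarrow> int) \<Rightarrow> nat" where
  "n1 F w = card {u \<in> vertices F. w u < 0}"

definition fmaj :: "plane_forest \<Rightarrow> (nat list \<Rightarrow> int) \<Rightarrow> nat" where
  "fmaj F w = 2 * maj F w + n1 F w"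

definition q_int :: "'a::comm_semiring_1 \<Rightarrow> nat \<Rightarrow> 'a" where
  "q_int q m = (\<Sum>i<m. q ^ i)"

text \<open>
  The vertex set and the set of labelings are finite, so the cardinalities and sums above
  are genuine.
\<close>

lemma vertices_Cons_image:
  "vertices F = (\<Union>i<length F. insert [i] ((#) i ` vertices (children (F ! i))))"
proof (rule set_eqI)
  fix u show "u \<in> vertices F \<longleftrightarrow>
    u \<in> (\<Union>i<length F. insert [i] ((#) i ` vertices (children (F ! i))))"
    by (cases u) (auto simp: vertices_def)
qed

lemma finite_vertices_children: "finite (vertices (children t))"
proof (induction t)
  case (Node ts)
  have "finite (vertices (children (ts ! i)))" if "i < length ts" for i
    using Node that by auto
  then show ?case
    by (subst vertices_Cons_image) auto
qed

lemma finite_vertices: "finite (vertices F)"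
  using finite_vertices_children[of "Node F"] by simp

lemma finite_signed_labelings: "finite (signed_labelings n F)"
proof -
  have "finite (vertices F \<rightarrow>\<^sub>E ({- int n..int n} - {0}))"
    by (intro finite_PiE finite_vertices) auto
  then show ?thesis
    unfolding signed_labelings_def by simp
qed

end

theory Submission
  imports Defs
begin

text \<open>
  Fix the set \<open>X\<close> of signed labels that occur: it contains exactly one of \<open>i\<close> and \<open>- i\<close> for
  each \<open>i\<close> in \<open>{1..n}\<close>. The number of negative labels depends only on \<open>X\<close>, so the
  contribution of \<open>X\<close> is a power of \<open>q\<close> times the generating function of \<open>2 * maj\<close> over all
  bijections from the vertices to \<open>X\<close>. By the hook length formula of Bjoerner and Wachs the
  latter is the same for all \<open>X\<close>, namely \<open>n! / \<Prod> h\<^sub>u\<close> times the product of the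
  \<open>[h\<^sub>u]\<close> taken at \<open>q\<^sup>2\<close>. Summing over the choices of signs gives the factor
  \<open>(1 + q) ^ n\<close>, and \<open>[2 * h] = (1 + q) * [h]\<close> with \<open>q\<^sup>2\<close> inside the last bracket
  (\<open>q_int_double\<close>).

  The unsigned formula (\<open>hook_formula_rooted_maj\<close>) admits a direct induction over the forest
  once it is generalised. Hang the whole forest under a virtual parent carrying an arbitrary
  label \<open>r\<close>, so that roots, too, can be descents. If the labels range over bijections to
  \<open>Y\<close>, the generating function is that for the ordinary \<open>maj\<close> multiplied by
  \<open>q ^ k\<close>, where \<open>k\<close> is the number of elements of \<open>Y\<close> above \<open>r\<close>.

  \<^item> If the forest splits into two parts, \<open>Y\<close> is split in all possible ways. The numbers
    \<open>k\<close> of the two parts add up to that of the whole, so all splittings contribute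
    equally, and counting them replaces the two factorials by the factorial of the total size.

  \<^item> If the forest is a single tree with \<open>n\<close> vertices, let \<open>s\<close> be the label of its root.
    The root contributes \<open>n\<close> if \<open>r < s\<close>, and the induction hypothesis, with \<open>s\<close> in the
    role of \<open>r\<close>, contributes the number \<open>j\<close> of labels above \<open>s\<close>. As \<open>s\<close> varies, \<open>j\<close> runs
    through \<open>0, \<dots>, n - 1\<close>, and \<open>r < s\<close> holds exactly for \<open>j < k\<close>. Hence the exponents
    are \<open>k, \<dots>, n + k - 1\<close>, which sum up to \<open>q ^ k * [n]\<close>
    (\<open>sum_power_shifted_ranks\<close>).
\<close>

section \<open>Sums over bijections\<close>

text \<open>
  Extensional functions, as in \<open>signed_labelings\<close>, so that a bijection on a disjoint union is
  uniquely a pair of bijections on the parts.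
\<close>

definition bijs :: "'a set \<Rightarrow> 'b set \<Rightarrow> ('a \<Rightarrow> 'b) set" where
  "bijs A Y = {w \<in> A \<rightarrow>\<^sub>E Y. bij_betw w A Y}"

text \<open>
  A bijection from \<open>A \<union> B\<close> to \<open>Y\<close> is determined by the image \<open>Z\<close> of \<open>A\<close> and by its
  restrictions to \<open>A\<close> and to \<open>B\<close>, which may be chosen independently.
\<close>

lemma sum_bijs_Un:
  assumes fin: "finite A" "finite B" "finite Y" and disj: "A \<inter> B = {}"
  shows "(\<Sum>w\<in>bijs (A \<union> B) Y. f w) =
    (\<Sum>Z | Z \<subseteq> Y \<and> card Z = card A. \<Sum>w1\<in>bijs A Z. \<Sum>w2\<in>bijs B (Y - Z).
       f (\<lambda>x. if x \<in> A then w1 x else w2 x))"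
proof -
  have finb: "finite (bijs C Z)" if "finite C" "finite Z" for C :: "'a set" and Z :: "'b set"
    using that by (auto simp: bijs_def intro!: finite_PiE)
  let ?I = "SIGMA Z:{Z. Z \<subseteq> Y \<and> card Z = card A}. bijs A Z \<times> bijs B (Y - Z)"
  have "(\<Sum>w\<in>bijs (A \<union> B) Y. f w) =
      (\<Sum>(Z, w1, w2)\<in>?I. f (\<lambda>x. if x \<in> A then w1 x else w2 x))"
  proof (rule sum.reindex_bij_witness[where
        i = "\<lambda>(Z, w1, w2) x. if x \<in> A then w1 x else w2 x" and
        j = "\<lambda>w. (w ` A, restrict w A, restrict w B)"])
    fix w assume w: "w \<in> bijs (A \<union> B) Y"
    then have bw: "bij_betw w (A \<union> B) Y" and ext: "w \<in> extensional (A \<union> B)"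
      by (auto simp: bijs_def PiE_def)
    have img: "Y = w ` A \<union> w ` B" and inj: "inj_on w (A \<union> B)"
      using bw by (auto simp: bij_betw_def)
    have injA: "inj_on w A" and injB: "inj_on w B"
      using inj by (auto intro: inj_on_subset)
    have sub: "w ` A \<subseteq> Y" using img by blast
    have YA: "Y - w ` A = w ` B"
      unfolding img using inj disj by (auto simp: inj_on_def)
    show *: "(\<lambda>(Z, w1, w2) x. if x \<in> A then w1 x else w2 x)
        (w ` A, restrict w A, restrict w B) = w"
      using ext by (auto simp: extensional_def)
    show "(case (w ` A, restrict w A, restrict w B) of
        (Z, w1, w2) \<Rightarrow> f (\<lambda>x. if x \<in> A then w1 x else w2 x)) = f w"
      using * by simp
    show "(w ` A, restrict w A, restrict w B) \<in> ?I"
      using injA injB sub by (auto simp: bijs_def YA bij_betw_def card_image)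
  next
    fix p assume "p \<in> ?I"
    then obtain Z w1 w2 where p: "p = (Z, w1, w2)" and Z: "Z \<subseteq> Y"
      and w1: "w1 \<in> bijs A Z" and w2: "w2 \<in> bijs B (Y - Z)" by auto
    let ?w = "\<lambda>x. if x \<in> A then w1 x else w2 x"
    have e1: "w1 x = undefined" if "x \<notin> A" for x
      using w1 that by (auto simp: bijs_def)
    have e2: "w2 x = undefined" if "x \<notin> B" for x
      using w2 that by (auto simp: bijs_def)
    have b1: "bij_betw ?w A Z"
      using w1 by (auto simp: bijs_def cong: bij_betw_cong)
    have "bij_betw w2 B (Y - Z) \<longleftrightarrow> bij_betw ?w B (Y - Z)"
      by (rule bij_betw_cong) (use disj in auto)
    then have b2: "bij_betw ?w B (Y - Z)"
      using w2 by (auto simp: bijs_def)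
    have "bij_betw ?w (A \<union> B) (Z \<union> (Y - Z))"
      by (rule bij_betw_combine[OF b1 b2]) auto
    then have b: "bij_betw ?w (A \<union> B) Y"
      using Z by (simp add: Un_absorb1)
    then have "?w \<in> (A \<union> B) \<rightarrow> Y"
      by (rule bij_betw_imp_funcset)
    then have "?w \<in> (A \<union> B) \<rightarrow>\<^sub>E Y"
      using e2 by (auto simp: PiE_def extensional_def)
    with b show "(\<lambda>(Z, w1, w2) x. if x \<in> A then w1 x else w2 x) p \<in> bijs (A \<union> B) Y"
      unfolding p bijs_def by simp
    have r1: "restrict ?w A = w1" using e1 by (auto simp: restrict_def)
    have r2: "restrict ?w B = w2" by (rule ext) (use e2 disj in auto)
    have "?w ` A = Z" using b1 by (simp add: bij_betw_def)
    with r1 r2 show "(\<lambda>w. (w ` A, restrict w A, restrict w B))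
        ((\<lambda>(Z, w1, w2) x. if x \<in> A then w1 x else w2 x) p) = p"
      unfolding p by simp
  qed
  also have "\<dots> = (\<Sum>Z | Z \<subseteq> Y \<and> card Z = card A. \<Sum>(w1, w2)\<in>bijs A Z \<times> bijs B (Y - Z).
      f (\<lambda>x. if x \<in> A then w1 x else w2 x))"
    using fin by (subst sum.Sigma) (auto intro!: finb dest: finite_subset)
  finally show ?thesis
    by (simp add: sum.cartesian_product)
qed

lemma sum_bijs_insert:
  assumes fin: "finite B" "finite Y" and u: "u \<notin> B"
  shows "(\<Sum>w\<in>bijs (insert u B) Y. f w) =
    (\<Sum>s\<in>Y. \<Sum>w2\<in>bijs B (Y - {s}). f (w2(u := s)))"
proof -
  have single: "bijs {u} {s} = {(\<lambda>x. undefined)(u := s)}" for s :: 'b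
    by (auto simp: bijs_def bij_betw_def PiE_def extensional_def)
  have Z: "{Z. Z \<subseteq> Y \<and> card Z = card {u}} = (\<lambda>s. {s}) ` Y"
    by (auto simp: card_1_singleton_iff)
  have fold: "(\<lambda>x. if x \<in> {u} then ((\<lambda>x. undefined)(u := s)) x else w2 x) = w2(u := s)"
    for s :: 'b and w2
    by auto
  have "(\<Sum>w\<in>bijs ({u} \<union> B) Y. f w) =
      (\<Sum>Z\<in>(\<lambda>s. {s}) ` Y. \<Sum>w1\<in>bijs {u} Z. \<Sum>w2\<in>bijs B (Y - Z).
        f (\<lambda>x. if x \<in> {u} then w1 x else w2 x))"
    unfolding Z[symmetric] by (rule sum_bijs_Un) (use fin u in auto)
  also have "\<dots> = (\<Sum>s\<in>Y. \<Sum>w1\<in>bijs {u} {s}. \<Sum>w2\<in>bijs B (Y - {s}).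
        f (\<lambda>x. if x \<in> {u} then w1 x else w2 x))"
    by (subst sum.reindex) (auto simp: inj_on_def)
  finally show ?thesis
    by (simp only: single fold sum.insert finite.emptyI empty_iff not_False_eq_True sum.empty
        add_0_right Un_insert_left Un_empty_left)
qed

text \<open>
  The element with \<open>j\<close> elements above it has exponent \<open>card Y + j\<close> or \<open>j\<close>, according to
  whether \<open>j < k\<close>, where \<open>k\<close> counts the elements above \<open>r\<close>. So the exponents \<open>0, \<dots>, k - 1\<close>
  are moved up behind \<open>card Y - 1\<close>, leaving the interval from \<open>k\<close> to \<open>k + card Y - 1\<close>.
\<close>

lemma sum_power_shifted_ranks:
  fixes Y :: "'b::linorder set" and q :: "'c::comm_semiring_1"
  assumes fin: "finite Y"
  shows "(\<Sum>s\<in>Y. q ^ ((if r < s then card Y else 0) + card {y\<in>Y. s < y})) =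
    q ^ card {y\<in>Y. r < y} * q_int q (card Y)"
proof -
  let ?rank = "\<lambda>s. card {y\<in>Y. s < y}"
  define k where "k = ?rank r"
  have kn: "k \<le> card Y"
    unfolding k_def by (rule card_mono) (use fin in auto)
  have less: "?rank t < ?rank s" if "s < t" "t \<in> Y" for s t
    by (rule psubset_card_mono) (use fin that in auto)
  have below: "?rank s < card Y" if "s \<in> Y" for s
    by (rule psubset_card_mono) (use fin that in auto)
  have inj: "inj_on ?rank Y"
  proof (rule inj_onI)
    fix s t assume "s \<in> Y" "t \<in> Y" "?rank s = ?rank t"
    then show "s = t"
      using less[of s t] less[of t s] by (cases s t rule: linorder_cases) auto
  qed
  have img: "?rank ` Y = {..<card Y}"
    by (rule card_subset_eq) (use below inj in \<open>auto simp: card_image\<close>)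
  have iff: "r < s \<longleftrightarrow> ?rank s < k" if "s \<in> Y" for s
  proof
    assume "r < s"
    then show "?rank s < k" using less[of r s] that by (auto simp: k_def)
  next
    assume *: "?rank s < k"
    show "r < s"
    proof (rule ccontr)
      assume "\<not> r < s"
      then have "k \<le> ?rank s"
        unfolding k_def by (intro card_mono) (use fin in auto)
      with * show False by simp
    qed
  qed
  have "(\<Sum>s\<in>Y. q ^ ((if r < s then card Y else 0) + ?rank s)) =
      (\<Sum>s\<in>Y. q ^ ((if ?rank s < k then card Y else 0) + ?rank s))"
    using iff by (intro sum.cong) auto
  also have "\<dots> = (\<Sum>j\<in>?rank ` Y. q ^ ((if j < k then card Y else 0) + j))"
    by (simp add: sum.reindex[OF inj])
  also have "\<dots> = (\<Sum>j<card Y. q ^ ((if j < k then card Y else 0) + j))"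
    by (simp only: img)
  also have "\<dots> = (\<Sum>j<card Y. q ^ (k + j))"
    by (rule sum.reindex_bij_witness[where
          i = "\<lambda>j. (if j < card Y - k then j + k else j + k - card Y)" and
          j = "\<lambda>j. (if j < k then j + card Y - k else j - k)"])
       (use kn in \<open>auto simp: add.commute split: if_splits\<close>)
  also have "\<dots> = q ^ k * q_int q (card Y)"
    by (simp add: q_int_def power_add sum_distrib_left)
  finally show ?thesis by (simp add: k_def)
qed

section \<open>The major index relative to a virtual parent label\<close>

text \<open>
  For the induction it is convenient to let the forest be just a set \<open>W\<close> of addresses; a
  subforest is then a subset, and no readdressing is needed when a tree or a root is removed.
\<close>

definition hook :: "'a list set \<Rightarrow> 'a list \<Rightarrow> nat" where
  "hook W u = card {v\<in>W. prefix u v}"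

definition parent_label :: "'b \<Rightarrow> 'a list set \<Rightarrow> ('a list \<Rightarrow> 'b) \<Rightarrow> 'a list \<Rightarrow> 'b" where
  "parent_label r W w u = (if butlast u \<in> W then w (butlast u) else r)"

definition rooted_maj :: "'b::linorder \<Rightarrow> 'a list set \<Rightarrow> ('a list \<Rightarrow> 'b) \<Rightarrow> nat" where
  "rooted_maj r W w = (\<Sum>u\<in>W. if parent_label r W w u < w u then hook W u else 0)"

text \<open>
  The addresses strictly between two members belong to \<open>W\<close> as well, so a member that properly
  extends another one has its parent in \<open>W\<close>. The empty address is excluded because it would be
  its own \<open>butlast\<close>, that is, its own parent.
\<close>

definition convex_addresses :: "'a list set \<Rightarrow> bool" where
  "convex_addresses W \<longleftrightarrow> finite W \<and> [] \<notin> W \<and>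
     (\<forall>u\<in>W. \<forall>v\<in>W. \<forall>x. prefix u x \<longrightarrow> prefix x v \<longrightarrow> x \<in> W)"

definition descendant_closed :: "'a list set \<Rightarrow> 'a list set \<Rightarrow> bool" where
  "descendant_closed W A \<longleftrightarrow> A \<subseteq> W \<and> (\<forall>u\<in>A. \<forall>v\<in>W. prefix u v \<longrightarrow> v \<in> A)"

lemma convex_addresses_closed:
  assumes "convex_addresses W" "descendant_closed W A"
  shows "convex_addresses A"
  using assms finite_subset[of A W]
  unfolding convex_addresses_def descendant_closed_def by blast

lemma hook_closed:
  assumes "descendant_closed W A" "u \<in> A"
  shows "hook W u = hook A u"
proof -
  have "{v\<in>W. prefix u v} = {v\<in>A. prefix u v}"
    using assms unfolding descendant_closed_def by blast
  then show ?thesis by (simp add: hook_def)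
qed

lemma rooted_maj_cong:
  assumes "\<And>u. u \<in> W \<Longrightarrow> w u = w' u"
  shows "rooted_maj r W w = rooted_maj r W w'"
  unfolding rooted_maj_def parent_label_def
  using assms by (intro sum.cong) auto

text \<open>
  No vertex of one part has its parent in the other, and hooks do not leave the parts. Roots of
  both parts are compared with the same \<open>r\<close>.
\<close>

lemma rooted_maj_Un:
  assumes fin: "finite A" "finite B" and disj: "A \<inter> B = {}"
    and A: "descendant_closed (A \<union> B) A" and B: "descendant_closed (A \<union> B) B"
  shows "rooted_maj r (A \<union> B) w = rooted_maj r A w + rooted_maj r B w"
proof -
  have "butlast u \<in> A" if "u \<in> A" "butlast u \<in> A \<union> B" for u
    using B disj that prefixeq_butlast[of u] unfolding descendant_closed_def by blast
  then have pA: "parent_label r (A \<union> B) w u = parent_label r A w u" if "u \<in> A" for u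
    using that by (auto simp: parent_label_def)
  have "butlast u \<in> B" if "u \<in> B" "butlast u \<in> A \<union> B" for u
    using A disj that prefixeq_butlast[of u] unfolding descendant_closed_def by blast
  then have pB: "parent_label r (A \<union> B) w u = parent_label r B w u" if "u \<in> B" for u
    using that by (auto simp: parent_label_def)
  show ?thesis
    unfolding rooted_maj_def sum.union_disjoint[OF fin disj]
    using hook_closed[OF A] hook_closed[OF B] pA pB
    by (intro arg_cong2[of _ _ _ _ "(+)"] sum.cong) auto
qed

text \<open>
  Removing the root \<open>u\<close> of a tree turns its children into roots; they are still compared with
  the label of \<open>u\<close>, which thereby becomes the new virtual parent label. The hook of \<open>u\<close> is the
  whole tree.
\<close>

lemma rooted_maj_insert:
  assumes conv: "convex_addresses (insert u B)" and u: "u \<notin> B"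
    and pre: "\<And>v. v \<in> B \<Longrightarrow> prefix u v"
  shows "rooted_maj r (insert u B) w =
    (if r < w u then card (insert u B) else 0) + rooted_maj (w u) B w"
proof -
  let ?W = "insert u B"
  have fin: "finite B" and ne: "u \<noteq> []"
    using conv by (auto simp: convex_addresses_def)
  have closed: "descendant_closed ?W B"
    unfolding descendant_closed_def using pre u by (auto dest: prefix_order.antisym)
  have hu: "hook ?W u = card ?W"
  proof -
    have "{v\<in>?W. prefix u v} = ?W" using pre by auto
    then show ?thesis by (simp add: hook_def)
  qed
  have bu: "butlast u \<notin> ?W"
  proof
    assume "butlast u \<in> ?W"
    then have "prefix u (butlast u)" using pre by auto
    then have "length u \<le> length u - 1" by (metis length_butlast prefix_length_le)
    then show False using ne by (simp add: Suc_le_eq[symmetric] not_le flip: length_greater_0_conv)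
  qed
  have pl: "parent_label r ?W w v = parent_label (w u) B w v" if v: "v \<in> B" for v
  proof -
    from v u have "v \<noteq> u" by auto
    with pre[OF v] have p: "prefix u (butlast v)"
      by (metis append_butlast_last_id prefix_Nil prefix_snoc)
    have "prefix (butlast v) v" by (rule prefixeq_butlast)
    then have "butlast v \<in> ?W"
      using conv p v unfolding convex_addresses_def by blast
    then show ?thesis by (auto simp: parent_label_def u)
  qed
  have "rooted_maj r ?W w = (if r < w u then card ?W else 0) +
      (\<Sum>v\<in>B. if parent_label r ?W w v < w v then hook ?W v else 0)"
    unfolding rooted_maj_def using fin u hu bu by (simp add: parent_label_def)
  also have "(\<Sum>v\<in>B. if parent_label r ?W w v < w v then hook ?W v else 0) = rooted_maj (w u) B w"
    unfolding rooted_maj_def using pl hook_closed[OF closed] by (intro sum.cong) auto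
  finally show ?thesis .
qed

section \<open>The hook length formula for unsigned labelings\<close>

lemma mult_factored_eqs:
  fixes a :: "'c::comm_semiring_1"
  assumes "a * x = f * p * P" "b * y = g * r * Q"
  shows "a * b * (x * y) = f * g * (p * r) * (P * Q)"
proof -
  have "a * b * (x * y) = (a * x) * (b * y)" by (simp only: mult_ac)
  then show ?thesis unfolding assms by (simp only: mult_ac)
qed

text \<open>
  The formula of Bjoerner and Wachs, strengthened by the virtual parent label \<open>r\<close> to make the
  induction go through. If no label exceeds \<open>r\<close>, it is the formula for the ordinary major
  index. The hook lengths are multiplied out, so that it holds in any commutative semiring.
\<close>

lemma hook_formula_rooted_maj:
  fixes Y :: "'b::linorder set" and q :: "'c::comm_semiring_1" and W :: "'a list set"
  assumes "convex_addresses W" "finite Y" "card Y = card W"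
  shows "of_nat (\<Prod>u\<in>W. hook W u) * (\<Sum>w\<in>bijs W Y. q ^ rooted_maj r W w) =
    of_nat (fact (card W)) * q ^ card {y\<in>Y. r < y} * (\<Prod>u\<in>W. q_int q (hook W u))"
  using assms
proof (induction "card W" arbitrary: W Y r rule: less_induct)
  case less
  note conv = less.prems(1) and finY = less.prems(2) and cY = less.prems(3)
  have finW: "finite W" using conv by (simp add: convex_addresses_def)
  show ?case
  proof (cases "W = {}")
    case True
    then have "Y = {}" using finY cY by simp
    have "bijs W Y = {\<lambda>x. undefined}"
      unfolding True \<open>Y = {}\<close> bijs_def by (auto simp: bij_betw_def)
    then show ?thesis by (simp add: True \<open>Y = {}\<close> rooted_maj_def)
  next
    case False
    \<comment> \<open>An address of minimal length is a root; its descendants form one tree \<open>A\<close> of the forest.\<close>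
    obtain u where u: "u \<in> W" and umin: "\<And>v. v \<in> W \<Longrightarrow> length u \<le> length v"
      using ex_min_if_finite[of "length ` W"] finW False
      by (metis (no_types, lifting) arg_min_if_finite(1) arg_min_least)
    define A where "A = {v\<in>W. prefix u v}"
    define B where "B = W - A"
    have uA: "u \<in> A" using u by (simp add: A_def)
    have WAB: "W = A \<union> B" and disj: "A \<inter> B = {}" by (auto simp: A_def B_def)
    have finA: "finite A" and finB: "finite B" using finW WAB by auto
    have clA: "descendant_closed W A"
      unfolding descendant_closed_def A_def by (auto intro: prefix_order.trans)
    have clB: "descendant_closed W B"
      unfolding descendant_closed_def
    proof (intro conjI ballI impI)
      \<comment> \<open>The prefixes \<open>u\<close> and \<open>x\<close> of \<open>y\<close> would be comparable, and \<open>u\<close> is not the longer one.\<close>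
      fix x y assume x: "x \<in> B" and y: "y \<in> W" and xy: "prefix x y"
      show "y \<in> B"
      proof (rule ccontr)
        assume "y \<notin> B"
        then have "prefix u y" using y by (auto simp: A_def B_def)
        moreover have "length u \<le> length x" using umin x by (auto simp: B_def)
        ultimately have "prefix u x" using xy by (metis prefix_length_prefix)
        then show False using x by (auto simp: A_def B_def)
      qed
    qed (auto simp: B_def)
    show ?thesis
    proof (cases "B = {}")
      case False
      have cW: "card W = card A + card B"
        unfolding WAB by (rule card_Un_disjoint[OF finA finB disj])
      have ltA: "card A < card W" and ltB: "card B < card W"
        using False uA finA finB cW by (auto simp: card_gt_0_iff)
      \<comment> \<open>By the induction hypotheses the summand for \<open>Z\<close> does not depend on \<open>Z\<close>.\<close>
      let ?N = "\<lambda>Z. card {y\<in>Z. r < y}"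
      have *: "of_nat (\<Prod>u\<in>A. hook A u) * of_nat (\<Prod>u\<in>B. hook B u) *
          (\<Sum>w1\<in>bijs A Z. \<Sum>w2\<in>bijs B (Y - Z).
            q ^ rooted_maj r W (\<lambda>x. if x \<in> A then w1 x else w2 x)) =
          of_nat (fact (card A)) * of_nat (fact (card B)) * q ^ ?N Y *
            ((\<Prod>u\<in>A. q_int q (hook A u)) * (\<Prod>u\<in>B. q_int q (hook B u)))"
        if Z: "Z \<subseteq> Y" "card Z = card A" for Z
      proof -
        have finZ: "finite Z" using Z finY finite_subset by blast
        have cB: "card (Y - Z) = card B"
          using Z cY cW finZ by (simp add: card_Diff_subset)
        have "rooted_maj r W (\<lambda>x. if x \<in> A then w1 x else w2 x) =
            rooted_maj r A w1 + rooted_maj r B w2" for w1 w2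
          unfolding WAB rooted_maj_Un[OF finA finB disj clA[unfolded WAB] clB[unfolded WAB]]
          using disj by (intro arg_cong2[of _ _ _ _ "(+)"] rooted_maj_cong) auto
        then have eq: "(\<Sum>w1\<in>bijs A Z. \<Sum>w2\<in>bijs B (Y - Z).
            q ^ rooted_maj r W (\<lambda>x. if x \<in> A then w1 x else w2 x)) =
            (\<Sum>w1\<in>bijs A Z. q ^ rooted_maj r A w1) *
            (\<Sum>w2\<in>bijs B (Y - Z). q ^ rooted_maj r B w2)"
          by (simp add: power_add sum_product)
        have IHA: "of_nat (\<Prod>u\<in>A. hook A u) * (\<Sum>w1\<in>bijs A Z. q ^ rooted_maj r A w1) =
            of_nat (fact (card A)) * q ^ ?N Z * (\<Prod>u\<in>A. q_int q (hook A u))"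
          by (rule less.hyps[OF ltA convex_addresses_closed[OF conv clA] finZ Z(2)])
        have IHB: "of_nat (\<Prod>u\<in>B. hook B u) *
            (\<Sum>w2\<in>bijs B (Y - Z). q ^ rooted_maj r B w2) =
            of_nat (fact (card B)) * q ^ ?N (Y - Z) * (\<Prod>u\<in>B. q_int q (hook B u))"
          by (rule less.hyps[OF ltB convex_addresses_closed[OF conv clB] _ cB]) (use finY in auto)
        have "?N Y = ?N Z + ?N (Y - Z)"
          using Z finY finZ by (subst card_Un_disjoint[symmetric]) (auto intro!: arg_cong[of _ _ card])
        then show ?thesis
          unfolding eq using mult_factored_eqs[OF IHA IHB] by (simp only: power_add)
      qed
      have sub: "(\<Sum>w\<in>bijs W Y. q ^ rooted_maj r W w) =
          (\<Sum>Z | Z \<subseteq> Y \<and> card Z = card A. \<Sum>w1\<in>bijs A Z. \<Sum>w2\<in>bijs B (Y - Z).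
            q ^ rooted_maj r W (\<lambda>x. if x \<in> A then w1 x else w2 x))"
        using sum_bijs_Un[OF finA finB finY disj, of "\<lambda>w. q ^ rooted_maj r W w"]
        by (simp only: WAB[symmetric])
      have prods: "(\<Prod>u\<in>W. g (hook W u)) = (\<Prod>u\<in>A. g (hook A u)) * (\<Prod>u\<in>B. g (hook B u))"
        for g :: "nat \<Rightarrow> 'd::comm_monoid_mult"
      proof -
        have "(\<Prod>u\<in>W. g (hook W u)) = (\<Prod>u\<in>A. g (hook W u)) * (\<Prod>u\<in>B. g (hook W u))"
          by (subst WAB) (rule prod.union_disjoint[OF finA finB disj])
        then show ?thesis
          by (simp add: hook_closed[OF clA] hook_closed[OF clB])
      qed
      have "(card W choose card A) * (fact (card A) * fact (card B)) = fact (card W)"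
        using binomial_fact_lemma[of "card A" "card W"] cW by (simp add: mult.commute)
      then have binom: "of_nat (card W choose card A) * (of_nat (fact (card A)) * of_nat (fact (card B))) =
          (of_nat (fact (card W)) :: 'c)"
        by (metis of_nat_mult)
      have "of_nat (\<Prod>u\<in>W. hook W u) * (\<Sum>w\<in>bijs W Y. q ^ rooted_maj r W w) =
          (\<Sum>Z | Z \<subseteq> Y \<and> card Z = card A.
            of_nat (fact (card A)) * of_nat (fact (card B)) * q ^ ?N Y *
            ((\<Prod>u\<in>A. q_int q (hook A u)) * (\<Prod>u\<in>B. q_int q (hook B u))))"
        unfolding sub prods[of "\<lambda>x. x"] of_nat_mult sum_distrib_left
        using * by (intro sum.cong) (auto simp: sum_distrib_left)
      also have "\<dots> = of_nat (card W choose card A) * (of_nat (fact (card A)) * of_nat (fact (card B))) * q ^ ?N Y *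
            (\<Prod>u\<in>W. q_int q (hook W u))"
        unfolding prods[of "q_int q"] by (simp add: n_subsets[OF finY] cY mult.assoc)
      finally show ?thesis by (simp only: binom)
    next
      case True
      \<comment> \<open>\<open>W\<close> is a tree with root \<open>u\<close>: sum over the label \<open>s\<close> of \<open>u\<close>.\<close>
      define C where "C = W - {u}"
      have WC: "W = insert u C" and uC: "u \<notin> C" using u by (auto simp: C_def)
      have pre: "prefix u v" if "v \<in> W" for v
        using that True by (auto simp: A_def B_def)
      have preC: "prefix u v" if "v \<in> C" for v
        using that pre by (simp add: C_def)
      have finC: "finite C" using finW by (simp add: C_def)
      have cW: "card W = Suc (card C)" using WC uC finC by simp
      have clC: "descendant_closed W C"
        unfolding descendant_closed_def C_def using pre by (auto dest: prefix_order.antisym)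
      have hu: "hook W u = card W"
      proof -
        have "{v\<in>W. prefix u v} = W" using pre by auto
        then show ?thesis by (simp add: hook_def)
      qed
      have prods: "(\<Prod>v\<in>W. g (hook W v)) = g (card W) * (\<Prod>v\<in>C. g (hook C v))"
        for g :: "nat \<Rightarrow> 'd::comm_monoid_mult"
      proof -
        have "(\<Prod>v\<in>W. g (hook W v)) = g (hook W u) * (\<Prod>v\<in>C. g (hook W v))"
          using prod.insert[OF finC uC] WC by metis
        then show ?thesis by (simp add: hu hook_closed[OF clC])
      qed
      have *: "of_nat (\<Prod>v\<in>C. hook C v) *
          (\<Sum>w\<in>bijs C (Y - {s}). q ^ rooted_maj r W (w(u := s))) =
          of_nat (fact (card C)) * (\<Prod>v\<in>C. q_int q (hook C v)) *
          q ^ ((if r < s then card Y else 0) + card {y\<in>Y. s < y})" if s: "s \<in> Y" for s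
      proof -
        have "rooted_maj r W (w(u := s)) = (if r < s then card Y else 0) + rooted_maj s C w" for w
        proof -
          have "rooted_maj s C (w(u := s)) = rooted_maj s C w"
            by (rule rooted_maj_cong) (use uC in auto)
          then show ?thesis
            using rooted_maj_insert[OF conv[unfolded WC] uC preC, of r "w(u := s)"]
            by (simp only: WC[symmetric] cY fun_upd_same)
        qed
        then have eq: "(\<Sum>w\<in>bijs C (Y - {s}). q ^ rooted_maj r W (w(u := s))) =
            q ^ (if r < s then card Y else 0) * (\<Sum>w\<in>bijs C (Y - {s}). q ^ rooted_maj s C w)"
          by (simp only: power_add sum_distrib_left)
        have IH: "of_nat (\<Prod>v\<in>C. hook C v) *
            (\<Sum>w\<in>bijs C (Y - {s}). q ^ rooted_maj s C w) =
            of_nat (fact (card C)) * q ^ card {y\<in>Y - {s}. s < y} * (\<Prod>v\<in>C. q_int q (hook C v))"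
          by (rule less.hyps[OF _ convex_addresses_closed[OF conv clC]])
             (use cW cY finY s in auto)
        have "{y\<in>Y - {s}. s < y} = {y\<in>Y. s < y}" by auto
        then show ?thesis
          unfolding eq mult.left_commute[of "of_nat _" "q ^ _"] IH
          by (simp only: power_add mult_ac)
      qed
      have sub: "(\<Sum>w\<in>bijs W Y. q ^ rooted_maj r W w) =
          (\<Sum>s\<in>Y. \<Sum>w\<in>bijs C (Y - {s}). q ^ rooted_maj r W (w(u := s)))"
        using sum_bijs_insert[OF finC finY uC, of "\<lambda>w. q ^ rooted_maj r W w"]
        by (simp only: WC[symmetric])
      have "of_nat (\<Prod>v\<in>C. hook C v) * (\<Sum>w\<in>bijs W Y. q ^ rooted_maj r W w) =
          of_nat (fact (card C)) * (\<Prod>v\<in>C. q_int q (hook C v)) *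
          (\<Sum>s\<in>Y. q ^ ((if r < s then card Y else 0) + card {y\<in>Y. s < y}))"
        unfolding sub sum_distrib_left[of _ _ Y] using * by (intro sum.cong) auto
      also have "\<dots> = of_nat (fact (card C)) * (\<Prod>v\<in>C. q_int q (hook C v)) *
          (q ^ card {y\<in>Y. r < y} * q_int q (card W))"
        unfolding sum_power_shifted_ranks[OF finY] by (simp only: cY)
      finally have "of_nat (card W) * (of_nat (\<Prod>v\<in>C. hook C v) *
          (\<Sum>w\<in>bijs W Y. q ^ rooted_maj r W w)) =
          of_nat (card W) * (of_nat (fact (card C)) * (\<Prod>v\<in>C. q_int q (hook C v)) *
          (q ^ card {y\<in>Y. r < y} * q_int q (card W)))"
        by (rule arg_cong)
      moreover have "of_nat (fact (card W)) = (of_nat (card W) * of_nat (fact (card C)) :: 'c)"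
        unfolding cW fact_Suc by (simp only: of_nat_mult of_nat_id)
      ultimately show ?thesis
        unfolding prods[of "\<lambda>x. x"] prods[of "q_int q"] of_nat_mult by (simp only: mult_ac)
    qed
  qed
qed

section \<open>Choosing the signs\<close>

lemma sum_power_card_Pow:
  fixes q :: "'a::comm_semiring_1"
  assumes "finite S"
  shows "(\<Sum>N\<in>Pow S. q ^ card N) = (1 + q) ^ card S"
  using prod_add[OF assms, of "\<lambda>_. q" "\<lambda>_. 1"] by (simp add: add.commute)

lemma q_int_double: "q_int q (2 * m) = (1 + q) * q_int (q\<^sup>2) m"
  by (induction m) (simp_all add: q_int_def algebra_simps power_mult power2_eq_square power_mult_distrib)

text \<open>
  The label set of a signed labeling whose negative labels have the absolute values \<open>N\<close>.
\<close>

definition sign_choice :: "nat \<Rightarrow> int set \<Rightarrow> int set" where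
  "sign_choice n N = uminus ` N \<union> ({1..int n} - N)"

text \<open>
  The absolute values of the labels are distinct, so \<open>i\<close> and \<open>- i\<close> never both occur, and the
  image of a signed labeling is determined by the set \<open>N\<close> of those \<open>i\<close> for which \<open>- i\<close>
  occurs.
\<close>

lemma signed_labelings_conv_bijs:
  "signed_labelings n F = (\<Union>N\<in>Pow {1..int n}. bijs (vertices F) (sign_choice n N))"
proof (intro set_eqI iffI)
  fix w assume w: "w \<in> signed_labelings n F"
  let ?V = "vertices F"
  have ext: "w \<in> extensional ?V" and bij: "bij_betw (\<lambda>u. \<bar>w u\<bar>) ?V {1..int n}"
    using w by (auto simp: signed_labelings_def PiE_def)
  have inj: "inj_on w ?V"
    using bij by (auto simp: bij_betw_def inj_on_def)
  have img: "(\<lambda>u. \<bar>w u\<bar>) ` ?V = {1..int n}" using bij by (simp add: bij_betw_def)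
  define N where "N = {i\<in>{1..int n}. - i \<in> w ` ?V}"
  have "w ` ?V = sign_choice n N"
  proof (intro set_eqI iffI)
    fix y assume "y \<in> w ` ?V"
    then obtain u where u: "u \<in> ?V" "y = w u" by auto
    then have y: "\<bar>y\<bar> \<in> {1..int n}" using img by auto
    show "y \<in> sign_choice n N"
    proof (cases "y < 0")
      case True
      then have "- y \<in> N" using y u by (auto simp: N_def)
      then show ?thesis unfolding sign_choice_def by (metis UnI1 image_eqI minus_minus)
    next
      case False
      have "y \<notin> N"
      proof
        assume "y \<in> N"
        then obtain v where v: "v \<in> ?V" "w v = - y" by (auto simp: N_def)
        then have "v = u" using bij u by (auto simp: bij_betw_def inj_on_def)
        then show False using v u y by auto
      qed
      then show ?thesis using False y by (auto simp: sign_choice_def)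
    qed
  next
    fix y assume "y \<in> sign_choice n N"
    then consider "- y \<in> N" | "y \<in> {1..int n}" "y \<notin> N" by (auto simp: sign_choice_def)
    then show "y \<in> w ` ?V"
    proof cases
      case 1 then show ?thesis by (auto simp: N_def)
    next
      case 2
      then obtain u where u: "u \<in> ?V" "\<bar>w u\<bar> = y" using img by (metis imageE)
      then have "w u = y" using 2 by (auto simp: N_def abs_if split: if_splits)
      then show ?thesis using u by auto
    qed
  qed
  then have "w \<in> bijs ?V (sign_choice n N)"
    using inj ext by (auto simp: bijs_def bij_betw_def PiE_def)
  moreover have "N \<in> Pow {1..int n}" by (auto simp: N_def)
  ultimately show "w \<in> (\<Union>N\<in>Pow {1..int n}. bijs ?V (sign_choice n N))" by blast
next
  fix w assume "w \<in> (\<Union>N\<in>Pow {1..int n}. bijs (vertices F) (sign_choice n N))"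
  then obtain N where N: "N \<subseteq> {1..int n}" and w: "w \<in> bijs (vertices F) (sign_choice n N)"
    by auto
  have "bij_betw abs (sign_choice n N) {1..int n}"
    unfolding bij_betw_def
  proof
    show "inj_on abs (sign_choice n N)"
      using N by (auto simp: inj_on_def sign_choice_def abs_if subset_iff split: if_splits)
    show "abs ` sign_choice n N = {1..int n}"
      using N by (force simp: sign_choice_def image_Un image_image)
  qed
  then have "bij_betw (\<lambda>u. \<bar>w u\<bar>) (vertices F) {1..int n}"
    using w bij_betw_trans[of w "vertices F" "sign_choice n N" abs] by (auto simp: bijs_def o_def)
  moreover have "sign_choice n N \<subseteq> {- int n..int n} - {0}"
    using N by (auto simp: sign_choice_def)
  ultimately show "w \<in> signed_labelings n F"
    using w by (auto simp: signed_labelings_def bijs_def PiE_def)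
qed

lemma negative_sign_choice:
  "N \<subseteq> {1..int n} \<Longrightarrow> {y \<in> sign_choice n N. y < 0} = uminus ` N"
  by (auto simp: sign_choice_def)

lemma n1_bijs:
  assumes "w \<in> bijs (vertices F) (sign_choice n N)" "N \<subseteq> {1..int n}"
  shows "n1 F w = card N"
proof -
  have b: "bij_betw w (vertices F) (sign_choice n N)" using assms by (simp add: bijs_def)
  have "w ` {u\<in>vertices F. w u < 0} = {y\<in>sign_choice n N. y < 0}"
    using b by (auto simp: bij_betw_def)
  moreover have "inj_on w {u\<in>vertices F. w u < 0}"
    using b by (auto simp: bij_betw_def intro: inj_on_subset)
  ultimately have "n1 F w = card (uminus ` N)"
    using negative_sign_choice[OF assms(2)] unfolding n1_def by (metis card_image)
  then show ?thesis by (simp add: card_image)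
qed

lemma card_sign_choice:
  assumes "N \<subseteq> {1..int n}"
  shows "card (sign_choice n N) = n"
proof -
  have fin: "finite N" using assms finite_subset by blast
  have "card (sign_choice n N) = card (uminus ` N) + card ({1..int n} - N)"
    unfolding sign_choice_def using assms fin by (intro card_Un_disjoint) auto
  also have "\<dots> = card N + (n - card N)"
    using assms fin by (simp add: card_image card_Diff_subset)
  also have "\<dots> = n"
    using card_mono[OF _ assms] by simp
  finally show ?thesis .
qed

lemma sum_signed_labelings:
  "(\<Sum>w\<in>signed_labelings n F. f w) =
    (\<Sum>N\<in>Pow {1..int n}. \<Sum>w\<in>bijs (vertices F) (sign_choice n N). f w)"
  unfolding signed_labelings_conv_bijs
proof (rule sum.UNION_disjoint)
  show "\<forall>N\<in>Pow {1..int n}. finite (bijs (vertices F) (sign_choice n N))"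
    using signed_labelings_conv_bijs[of n F] finite_signed_labelings[of n F]
    by (auto intro: finite_subset)
  show "\<forall>N\<in>Pow {1..int n}. \<forall>M\<in>Pow {1..int n}. N \<noteq> M \<longrightarrow>
      bijs (vertices F) (sign_choice n N) \<inter> bijs (vertices F) (sign_choice n M) = {}"
  proof (intro ballI impI equals0I)
    fix N M w assume NM: "N \<in> Pow {1..int n}" "M \<in> Pow {1..int n}" "N \<noteq> M"
      and w: "w \<in> bijs (vertices F) (sign_choice n N) \<inter> bijs (vertices F) (sign_choice n M)"
    then have "sign_choice n N = sign_choice n M"
      by (auto simp: bijs_def bij_betw_def)
    then have "uminus ` N = uminus ` M"
      using NM negative_sign_choice[of N n] negative_sign_choice[of M n] by auto
    then show False using NM by (simp add: inj_image_eq_iff)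
  qed
qed simp

section \<open>Plane forests as sets of addresses\<close>

lemma is_vertex_prefix: "is_vertex F v \<Longrightarrow> prefix u v \<Longrightarrow> u \<noteq> [] \<Longrightarrow> is_vertex F u"
proof (induction F v arbitrary: u rule: is_vertex.induct)
  case (2 F i p)
  then obtain p' where u: "u = i # p'" and p': "prefix p' p" by (cases u) auto
  then show ?case using 2 by (cases "p' = []") auto
qed simp

lemma convex_addresses_vertices: "convex_addresses (vertices F)"
  unfolding convex_addresses_def
proof (intro conjI ballI allI impI)
  show "finite (vertices F)" by (rule finite_vertices)
  show ne: "[] \<notin> vertices F" by (simp add: vertices_def)
  fix u v x assume "u \<in> vertices F" "v \<in> vertices F" "prefix u x" "prefix x v"
  then show "x \<in> vertices F"
    using ne is_vertex_prefix[of F v x] by (cases "x = []") (auto simp: vertices_def)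
qed

text \<open>
  A virtual parent whose label is at least as large as all others turns no root into a descent.
\<close>

lemma maj_conv_rooted_maj:
  assumes "\<And>u. u \<in> vertices F \<Longrightarrow> w u \<le> r"
  shows "maj F w = rooted_maj r (vertices F) w"
proof -
  have ne: "[] \<notin> vertices F" by (simp add: vertices_def)
  have par: "is_parent F v u \<longleftrightarrow> v \<in> vertices F \<and> v = butlast u" if "u \<in> vertices F" for u v
    using that ne unfolding is_parent_def
    by (metis append_butlast_last_id butlast_snoc)
  have "Des F w = {u\<in>vertices F. parent_label r (vertices F) w u < w u}"
    using assms par by (force simp: Des_def parent_label_def split: if_splits)
  then show ?thesis
    unfolding maj_def rooted_maj_def
    by (simp add: sum.inter_filter[OF finite_vertices] hook_length_def hook_def cong: if_cong)
qed

section \<open>The hook length formula for signed labelings\<close>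

theorem theorem2p3:
  fixes F :: plane_forest and n :: nat and q :: "rat poly"
  defines "q \<equiv> [:0, 1:]"
  assumes "forest_size F = n"
  shows "(\<Sum>w\<in>signed_labelings n F. q ^ fmaj F w)
       = smult (fact n / (\<Prod>u\<in>vertices F. of_nat (hook_length F u)))
           (\<Prod>u\<in>vertices F. q_int q (2 * hook_length F u))"
proof -
  let ?V = "vertices F"
  have cV: "card ?V = n" using assms(2) by (simp add: forest_size_def)
  have hk: "hook_length F = hook ?V" by (auto simp: fun_eq_iff hook_length_def hook_def)
  define H where "H = (\<Prod>u\<in>?V. hook ?V u)"
  have "hook ?V u \<noteq> 0" if "u \<in> ?V" for u
    using that finite_vertices[of F] by (auto simp: hook_def)
  then have H0: "H \<noteq> 0" by (simp add: H_def finite_vertices)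
  have *: "of_nat H * (\<Sum>w\<in>bijs ?V (sign_choice n N). q ^ fmaj F w) =
      q ^ card N * (fact n * (\<Prod>u\<in>?V. q_int (q\<^sup>2) (hook ?V u)))" if N: "N \<subseteq> {1..int n}" for N
  proof -
    let ?X = "sign_choice n N"
    have le: "y \<le> int n" if "y \<in> ?X" for y using that N by (auto simp: sign_choice_def)
    have fin: "finite ?X" using N finite_subset by (auto simp: sign_choice_def)
    \<comment> \<open>No label exceeds \<open>n\<close>, so \<open>n\<close> can serve as the virtual parent label.\<close>
    have none: "{y\<in>?X. int n < y} = {}" using le by force
    have "q ^ fmaj F w = q ^ card N * (q\<^sup>2) ^ rooted_maj (int n) ?V w" if w: "w \<in> bijs ?V ?X" for w
    proof -
      have "maj F w = rooted_maj (int n) ?V w"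
        by (rule maj_conv_rooted_maj) (use w le in \<open>auto simp: bijs_def\<close>)
      then show ?thesis
        using n1_bijs[OF w N] by (simp add: fmaj_def power_add power_mult mult.commute)
    qed
    then have "of_nat H * (\<Sum>w\<in>bijs ?V ?X. q ^ fmaj F w) =
        q ^ card N * (of_nat H * (\<Sum>w\<in>bijs ?V ?X. (q\<^sup>2) ^ rooted_maj (int n) ?V w))"
      by (simp add: sum_distrib_left[symmetric] mult.left_commute)
    also have "of_nat H * (\<Sum>w\<in>bijs ?V ?X. (q\<^sup>2) ^ rooted_maj (int n) ?V w) =
        fact n * (\<Prod>u\<in>?V. q_int (q\<^sup>2) (hook ?V u))"
      using hook_formula_rooted_maj[OF convex_addresses_vertices fin, of F "q\<^sup>2" "int n"]
      by (simp only: of_nat_fact card_sign_choice[OF N] cV none H_def card.empty power_0 mult_1_right)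
    finally show ?thesis .
  qed
  have "of_nat H * (\<Sum>w\<in>signed_labelings n F. q ^ fmaj F w) =
      (\<Sum>N\<in>Pow {1..int n}. q ^ card N * (fact n * (\<Prod>u\<in>?V. q_int (q\<^sup>2) (hook ?V u))))"
    unfolding sum_signed_labelings sum_distrib_left[of _ _ "Pow _"]
    using * by (intro sum.cong) auto
  also have "\<dots> = (1 + q) ^ n * (fact n * (\<Prod>u\<in>?V. q_int (q\<^sup>2) (hook ?V u)))"
    by (simp only: sum_distrib_right[symmetric] sum_power_card_Pow[OF finite_atLeastAtMost_int]) simp
  also have "\<dots> = fact n * (\<Prod>u\<in>?V. q_int q (2 * hook ?V u))"
    by (simp add: q_int_double prod.distrib cV mult.left_commute)
  finally have eq: "of_nat H * (\<Sum>w\<in>signed_labelings n F. q ^ fmaj F w) =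
      fact n * (\<Prod>u\<in>?V. q_int q (2 * hook ?V u))" .
  have const: "smult (of_nat m) p = of_nat m * p" for m and p :: "rat poly"
    by (simp add: of_nat_poly)
  have "smult (of_nat H) (\<Sum>w\<in>signed_labelings n F. q ^ fmaj F w) =
      smult (fact n) (\<Prod>u\<in>?V. q_int q (2 * hook ?V u))"
    using eq const[of H] const[of "fact n"] by (simp only: of_nat_fact)
  then have "smult (1 / of_nat H) (smult (of_nat H) (\<Sum>w\<in>signed_labelings n F. q ^ fmaj F w)) =
      smult (1 / of_nat H) (smult (fact n) (\<Prod>u\<in>?V. q_int q (2 * hook ?V u)))"
    by (rule arg_cong)
  then have "(\<Sum>w\<in>signed_labelings n F. q ^ fmaj F w) =
      smult (fact n / of_nat H) (\<Prod>u\<in>?V. q_int q (2 * hook ?V u))"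
    using H0 by simp
  then show ?thesis
    by (simp add: hk H_def)
qed

end
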